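(* (1) There are exactly $36\cdot(3!)^5=279936$ admissible statements. (2) Among the sets of 15 numbers occurring in the first five columns of admissible statements, there are exactly twenty that are different from the set of 15 numbers in the first five columns of the standard partition. (3) Choose one admissible statement for each of these twenty sets and apply the algorithm to it. Of the twenty partitions obtained, exactly one is equivalent to the standard partition.
   Context: A partition of the non-negative integers into three sets $A,B,C$ is considered together with enumerations without repetition $A=\{a_k\mid k\ge 1\}$, $B=\{b_k\mid k\ge 1\}$, $C=\{c_k\mid k\ge 1\}$ (not required to be increasing): every non-negative integer occurs exactly once among the $a_k,b_k,c_k$. The $k$-th column is $(a_k,b_k,c_k)$. An admissible statement is a choice of 14 distinct non-negative integers $a_1,\dots,a_5$, $b_1,\dots,b_5$, $c_1,\dots,c_4$ such that $a_k+b_k+c_k$ equals $3,12,23,32$ for $k=1,2,3,4$ respectively, and such that the fifth sum can be $43$, i.e. $c_5:=43-a_5-b_5$ is a non-negative integer different from the 14 chosen ones. Its first five columns are $(a_k,b_k,c_k)$, $1\le k\le 5$ (with this $c_5$). Algorithm: starting from the first five columns, for $n=6,7,8,\dots$ successively, let $a_n<b_n$ be the two smallest non-negative integers not used in columns $1,\dots,n-1$, and let $c_n=S(n)-a_n-b_n$, where $S(n)=11n-2\lfloor n/2\rfloor-8$. The standard partition of the non-negative integers is given by the three sets, enumerated by $n\ge 1$, $$S_1=\{3n-\lfloor n/2\rfloor-2\mid n\ge 1\},\quad S_2=\{3n-\lfloor n/2\rfloor-1\mid n\ge 1\},\quad S_3=\{5n-5\mid n\ge 1\}.$$ Two partitions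 $A=\{a_k\},B=\{b_k\},C=\{c_k\}$ and $D=\{d_k\},E=\{e_k\},F=\{f_k\}$ ($k\ge 1$) of the non-negative integers are equivalent if there exists a number $N$ such that $a_k=d_k$, $b_k=e_k$ and $c_k=f_k$ for all $k>N$. *)

theory Defs
  imports Main
begin

text \<open>
  Partitions are given column by column: \<open>p k = (a\<^sub>k, b\<^sub>k, c\<^sub>k)\<close> for \<open>k \<ge> 1\<close>, the value at
  \<open>k = 0\<close> being irrelevant. All numbers are integers, with non-negativity stated explicitly, so
  that no subtraction is truncated.
\<close>

type_synonym column = "int \<times> int \<times> int"

fun entries :: "column \<Rightarrow> int set" where
  "entries (a, b, c) = {a, b, c}"

definition is_partition :: "(nat \<Rightarrow> column) \<Rightarrow> bool" where
  "is_partition p \<longleftrightarrow>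
     (let a = (\<lambda>k. fst (p k)); b = (\<lambda>k. fst (snd (p k))); c = (\<lambda>k. snd (snd (p k)))
      in inj_on a {1..} \<and> inj_on b {1..} \<and> inj_on c {1..} \<and>
         a ` {1..} \<inter> b ` {1..} = {} \<and> a ` {1..} \<inter> c ` {1..} = {} \<and> b ` {1..} \<inter> c ` {1..} = {} \<and>
         a ` {1..} \<union> b ` {1..} \<union> c ` {1..} = {0..})"

definition equivalent :: "(nat \<Rightarrow> column) \<Rightarrow> (nat \<Rightarrow> column) \<Rightarrow> bool" where
  "equivalent p q \<longleftrightarrow> (\<exists>N. \<forall>k>N. p k = q k)"

definition standard :: "nat \<Rightarrow> column" where
  "standard n =
     (3 * int n - int (n div 2) - 2, 3 * int n - int (n div 2) - 1, 5 * int n - 5)"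

text \<open>
  A statement is a triple of lists \<open>[a\<^sub>1, \<dots>, a\<^sub>5]\<close>, \<open>[b\<^sub>1, \<dots>, b\<^sub>5]\<close>, \<open>[c\<^sub>1, \<dots>, c\<^sub>4]\<close>; list indices
  start at 0, so \<open>a\<^sub>k\<close> is \<open>as ! (k - 1)\<close>.
\<close>

type_synonym stmt = "int list \<times> int list \<times> int list"

fun c5 :: "stmt \<Rightarrow> int" where
  "c5 (as, bs, cs) = 43 - as ! 4 - bs ! 4"

definition admissible :: "stmt set" where
  "admissible = {(as, bs, cs).
     length as = 5 \<and> length bs = 5 \<and> length cs = 4 \<and>
     distinct (as @ bs @ cs) \<and> (\<forall>x \<in> set (as @ bs @ cs). 0 \<le> x) \<and>
     (\<forall>i<4. as ! i + bs ! i + cs ! i = [3, 12, 23, 32] ! i) \<and>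
     0 \<le> c5 (as, bs, cs) \<and> c5 (as, bs, cs) \<notin> set (as @ bs @ cs)}"

fun initial_column :: "stmt \<Rightarrow> nat \<Rightarrow> column" where
  "initial_column (as, bs, cs) k =
     (as ! (k - 1), bs ! (k - 1), (cs @ [c5 (as, bs, cs)]) ! (k - 1))"

definition S :: "nat \<Rightarrow> int" where
  "S n = 11 * int n - 2 * int (n div 2) - 8"

fun algorithm :: "stmt \<Rightarrow> nat \<Rightarrow> column" where
  "algorithm s n =
     (if n \<le> 5 then initial_column s n
      else let used = (\<Union>k\<in>{1..<n}. entries (algorithm s k));
               a = (LEAST x. 0 \<le> x \<and> x \<notin> used);
               b = (LEAST x. a < x \<and> x \<notin> used)
           in (a, b, S n - a - b))"

declare algorithm.simps [simp del]

definition first_five :: "(nat \<Rightarrow> column) \<Rightarrow> int set" where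
  "first_five p = (\<Union>k\<in>{1..5}. entries (p k))"

definition nonstandard_sets :: "int set set" where
  "nonstandard_sets =
     {X. (\<exists>s\<in>admissible. X = first_five (initial_column s)) \<and> X \<noteq> first_five standard}"

end

theory Submission
  imports Defs
begin

text \<open>
  Permuting the entries inside each of the five columns turns the count of admissible statements
  into \<open>6 ^ 5\<close> times the number of packings with increasing columns, of which there are 36.

  The algorithm depends on the initial columns only through their set of entries. Group the
  non-negative integers into the blocks \<open>{5 * m - 2..5 * m + 2}\<close>. After a transient phase that
  ends with column 13, the third entry of column \<open>m + 1\<close> lies in block \<open>m\<close>, and the four other
  elements of this block are the first two entries of columns \<open>2 * m\<close> and \<open>2 * m + 1\<close>. The deviation
  \<open>d\<close> of the third entry of column \<open>m + 1\<close> from the standard value \<open>5 * m\<close> propagates to deviation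
  \<open>min d 0\<close> in column \<open>2 * m\<close> and \<open>max d 0\<close> in column \<open>2 * m + 1\<close>, so a nonzero deviation never
  dies out, and equivalence with the standard partition is decided by columns 8 to 13.
\<close>

section \<open>Counting admissible statements\<close>

abbreviation third :: "column \<Rightarrow> int" where
  "third t \<equiv> snd (snd t)"

abbreviation entry_list :: "column \<Rightarrow> int list" where
  "entry_list \<equiv> \<lambda>(a, b, c). [a, b, c]"

lemma set_entry_list: "set (entry_list t) = entries t"
  by (cases t) simp

section \<open>Packings of columns with prescribed sums, and sorting inside the columns\<close>

definition triples :: "int \<Rightarrow> int set \<Rightarrow> column set" where
  "triples s U = {(a, b, c). 0 \<le> a \<and> 0 \<le> b \<and> 0 \<le> c \<and> a \<noteq> b \<and> a \<noteq> c \<and> b \<noteq> c \<and>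
     a + b + c = s \<and> a \<notin> U \<and> b \<notin> U \<and> c \<notin> U}"

definition increasing :: "column set" where
  "increasing = {(a, b, c). a < b \<and> b < c}"

text \<open>\<open>U\<close> carries the entries of the earlier columns. \<open>V = UNIV\<close>
  gives all ordered columns; \<open>V = increasing\<close> gives one representative for each class
  under permutations inside columns.\<close>

fun packings :: "column set \<Rightarrow> int list \<Rightarrow> int set \<Rightarrow> column list set" where
  "packings V [] U = {[]}"
| "packings V (s # ss) U = (\<Union>t\<in>triples s U \<inter> V. (#) t ` packings V ss (U \<union> entries t))"

lemma finite_triples: "finite (triples s U)"
proof (rule finite_subset)
  show "triples s U \<subseteq> {0..s} \<times> {0..s} \<times> {0..s}"
    by (auto simp: triples_def)
qed simp

lemma finite_packings: "finite (packings V ss U)"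
  by (induction ss arbitrary: U) (auto intro: finite_triples)

lemma card_packings_Cons:
  "card (packings V (s # ss) U) = (\<Sum>t\<in>triples s U \<inter> V. card (packings V ss (U \<union> entries t)))"
proof -
  have "card (packings V (s # ss) U) =
      (\<Sum>t\<in>triples s U \<inter> V. card ((#) t ` packings V ss (U \<union> entries t)))"
    unfolding packings.simps
    by (rule card_UN_disjoint) (auto simp: finite_triples finite_packings)
  then show ?thesis
    by (simp add: card_image)
qed

text \<open>\<open>\<sigma>\<close> permutes positions and \<open>\<tau>\<close> is its inverse. As
  \<open>g\<close> sees only the set of entries, the columns that \<open>\<sigma>\<close> sorts
  carry the same total weight as the sorted ones.\<close>

lemma sum_triples_reindex:
  fixes g :: "int set \<Rightarrow> nat" and \<sigma> \<tau> :: "column \<Rightarrow> column"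
  assumes "\<And>t. \<sigma> (\<tau> t) = t" "\<And>t. \<tau> (\<sigma> t) = t" "\<And>t. entries (\<sigma> t) = entries t"
    "\<And>t. \<sigma> t \<in> triples s U \<longleftrightarrow> t \<in> triples s U"
  shows "(\<Sum>t\<in>triples s U. if \<sigma> t \<in> increasing then g (entries t) else 0) =
    (\<Sum>t\<in>triples s U \<inter> increasing. g (entries t))"
proof -
  have "(\<Sum>t\<in>triples s U. if \<sigma> t \<in> increasing then g (entries t) else 0) =
      (\<Sum>t\<in>{t \<in> triples s U. \<sigma> t \<in> increasing}. g (entries t))"
    by (simp add: sum.inter_filter finite_triples)
  also have "\<dots> = (\<Sum>t\<in>triples s U \<inter> increasing. g (entries t))"
    by (rule sum.reindex_bij_witness[of _ \<tau> \<sigma>]) (use assms in \<open>simp_all, metis+\<close>)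
  finally show ?thesis .
qed

lemma sum_triples_increasing:
  fixes g :: "int set \<Rightarrow> nat"
  shows "(\<Sum>t\<in>triples s U. g (entries t)) = 6 * (\<Sum>t\<in>triples s U \<inter> increasing. g (entries t))"
proof -
  let ?w = "\<lambda>\<sigma> t. if \<sigma> t \<in> increasing then g (entries t) else 0"
  let ?\<sigma>2 = "\<lambda>(a, b, c). (a, c, b)" and ?\<sigma>3 = "\<lambda>(a, b, c). (b, a, c)"
  let ?\<sigma>4 = "\<lambda>(a, b, c). (b, c, a)" and ?\<sigma>5 = "\<lambda>(a, b, c). (c, a, b)"
  let ?\<sigma>6 = "\<lambda>(a, b, c). (c, b, a)"
  let ?R = "\<Sum>t\<in>triples s U \<inter> increasing. g (entries t)"
  \<comment> \<open>Distinct entries are sorted by exactly one of the six permutations, so exactly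
    one summand survives.\<close>
  have "(\<Sum>t\<in>triples s U. g (entries t)) =
      (\<Sum>t\<in>triples s U. ?w (\<lambda>t. t) t + ?w ?\<sigma>2 t + ?w ?\<sigma>3 t + ?w ?\<sigma>4 t + ?w ?\<sigma>5 t + ?w ?\<sigma>6 t)"
    by (rule sum.cong) (auto simp: triples_def increasing_def)
  \<comment> \<open>The identity and the three transpositions are their own inverses; the 3-cycles
    \<open>?\<sigma>4\<close> and \<open>?\<sigma>5\<close> are inverse to each other.\<close>
  also have "\<dots> = ?R + ?R + ?R + ?R + ?R + ?R"
    unfolding sum.distrib
    by (intro arg_cong2[where f = "(+)"]
        sum_triples_reindex[where \<sigma> = "\<lambda>t. t" and \<tau> = "\<lambda>t. t"]
        sum_triples_reindex[where \<sigma> = ?\<sigma>2 and \<tau> = ?\<sigma>2]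
        sum_triples_reindex[where \<sigma> = ?\<sigma>3 and \<tau> = ?\<sigma>3]
        sum_triples_reindex[where \<sigma> = ?\<sigma>4 and \<tau> = ?\<sigma>5]
        sum_triples_reindex[where \<sigma> = ?\<sigma>5 and \<tau> = ?\<sigma>4]
        sum_triples_reindex[where \<sigma> = ?\<sigma>6 and \<tau> = ?\<sigma>6])
      (auto simp: triples_def split: prod.splits)
  finally show ?thesis
    by simp
qed

text \<open>Later columns feel an earlier one only through its set of entries, so each column
  independently contributes a factor 6.\<close>

lemma card_packings_increasing:
  "card (packings UNIV ss U) = 6 ^ length ss * card (packings increasing ss U)"
proof (induction ss arbitrary: U)
  case Nil
  then show ?case by simp
next
  case (Cons s ss)
  show ?case
    unfolding card_packings_Cons
    using sum_triples_increasing[of "\<lambda>E. card (packings increasing ss (U \<union> E))" s U]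
    by (simp add: Cons.IH flip: sum_distrib_left)
qed

lemma ex_increasing_triple:
  assumes "t \<in> triples s U"
  shows "\<exists>t'\<in>triples s U \<inter> increasing. entries t' = entries t"
proof -
  obtain a b c where t: "t = (a, b, c)"
    by (cases t)
  with assms have "a < b \<and> b < c \<or> a < c \<and> c < b \<or> b < a \<and> a < c \<or> b < c \<and> c < a \<or>
      c < a \<and> a < b \<or> c < b \<and> b < a"
    by (auto simp: triples_def)
  then show ?thesis
  proof (elim disjE)
    assume "a < b \<and> b < c"
    with assms t show ?thesis
      by (intro bexI[of _ "(a, b, c)"]) (auto simp: triples_def increasing_def)
  next
    assume "a < c \<and> c < b"
    with assms t show ?thesis
      by (intro bexI[of _ "(a, c, b)"]) (auto simp: triples_def increasing_def)
  next
    assume "b < a \<and> a < c"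
    with assms t show ?thesis
      by (intro bexI[of _ "(b, a, c)"]) (auto simp: triples_def increasing_def)
  next
    assume "b < c \<and> c < a"
    with assms t show ?thesis
      by (intro bexI[of _ "(b, c, a)"]) (auto simp: triples_def increasing_def)
  next
    assume "c < a \<and> a < b"
    with assms t show ?thesis
      by (intro bexI[of _ "(c, a, b)"]) (auto simp: triples_def increasing_def)
  next
    assume "c < b \<and> b < a"
    with assms t show ?thesis
      by (intro bexI[of _ "(c, b, a)"]) (auto simp: triples_def increasing_def)
  qed
qed

lemma packing_mono: "packings increasing ss U \<subseteq> packings UNIV ss U"
  by (induction ss arbitrary: U) fastforce+

text \<open>Sorting each column keeps the set of numbers used, so the increasing packings already
  exhibit every possible set.\<close>

lemma Union_packings_increasing:
  "(\<lambda>ts. \<Union> (entries ` set ts)) ` packings UNIV ss U =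
   (\<lambda>ts. \<Union> (entries ` set ts)) ` packings increasing ss U"
proof
  have "\<exists>ts'\<in>packings increasing ss U. \<Union> (entries ` set ts) = \<Union> (entries ` set ts')"
    if "ts \<in> packings UNIV ss U" for ts
    using that
  proof (induction ss arbitrary: U ts)
    case Nil
    then show ?case by simp
  next
    case (Cons s ss)
    then obtain t us where t: "t \<in> triples s U" and us: "us \<in> packings UNIV ss (U \<union> entries t)"
      and ts: "ts = t # us"
      by auto
    obtain t' where t': "t' \<in> triples s U \<inter> increasing" "entries t' = entries t"
      using ex_increasing_triple[OF t] by blast
    obtain us' where "us' \<in> packings increasing ss (U \<union> entries t)"
      "\<Union> (entries ` set us) = \<Union> (entries ` set us')"
      using Cons.IH[OF us] by blast
    with t' ts show ?case
      by (intro bexI[of _ "t' # us'"]) (auto intro!: bexI[of _ t'])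
  qed
  then show "(\<lambda>ts. \<Union> (entries ` set ts)) ` packings UNIV ss U \<subseteq>
      (\<lambda>ts. \<Union> (entries ` set ts)) ` packings increasing ss U"
    by blast
qed (use packing_mono in blast)

section \<open>Executable enumeration of the increasing packings\<close>

fun increasing_triples :: "int \<Rightarrow> int list \<Rightarrow> column list" where
  "increasing_triples s U =
     [(a, b, s - a - b). a \<leftarrow> filter (\<lambda>x. x \<notin> set U) [0..s],
        b \<leftarrow> filter (\<lambda>x. x \<notin> set U) [a + 1..s - a], b < s - a - b, s - a - b \<notin> set U]"

fun increasing_packings :: "int list \<Rightarrow> int list \<Rightarrow> column list list" where
  "increasing_packings [] U = [[]]"
| "increasing_packings (s # ss) U =
     concat (map (\<lambda>(a, b, c). map ((#) (a, b, c)) (increasing_packings ss (a # b # c # U)))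
       (increasing_triples s U))"

lemma set_increasing_triples: "set (increasing_triples s U) = triples s (set U) \<inter> increasing"
  by (auto simp: triples_def increasing_def)

lemma set_increasing_packings:
  "set (increasing_packings ss U) = packings increasing ss (set U)"
proof (induction ss arbitrary: U)
  case Nil
  then show ?case by simp
next
  case (Cons s ss)
  have "set (increasing_packings ss (a # b # c # U)) =
      packings increasing ss (set U \<union> entries (a, b, c))" for a b c
    unfolding Cons.IH by (simp add: insert_commute Un_commute)
  then show ?case
    unfolding increasing_packings.simps packings.simps set_increasing_triples[symmetric]
    by (simp del: increasing_triples.simps entries.simps) (auto simp del: increasing_triples.simps)
qed

abbreviation target_sums :: "int list" where
  "target_sums \<equiv> [3, 12, 23, 32, 43]"

lemma card_increasing_packings: "card (set (increasing_packings target_sums [])) = 36"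
  by code_simp

section \<open>Admissible statements as packings of five columns\<close>

abbreviation initial_columns :: "stmt \<Rightarrow> column list" where
  "initial_columns s \<equiv> map (initial_column s) [1..<6]"

lemma upt_1_6: "[Suc 0..<6] = [1, 2, 3, 4, 5]"
  by code_simp

lemma length_eq_5: "length xs = 5 \<longleftrightarrow> (\<exists>a b c d e. xs = [a, b, c, d, e])"
  by (auto simp: numeral_eq_Suc length_Suc_conv)

lemma length_eq_4: "length xs = 4 \<longleftrightarrow> (\<exists>a b c d. xs = [a, b, c, d])"
  by (auto simp: numeral_eq_Suc length_Suc_conv)

lemma admissibleE:
  assumes "s \<in> admissible"
  obtains a1 a2 a3 a4 a5 b1 b2 b3 b4 b5 c1 c2 c3 c4 where
    "s = ([a1, a2, a3, a4, a5], [b1, b2, b3, b4, b5], [c1, c2, c3, c4])"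
  using assms by (auto simp: admissible_def length_eq_5 length_eq_4)

lemma all_less_4: "(\<forall>i<4. P i) \<longleftrightarrow> P 0 \<and> P 1 \<and> P 2 \<and> P (3::nat)"
  by (auto simp: numeral_eq_Suc less_Suc_eq)

lemma Cons_in_packings_UNIV:
  "t # us \<in> packings UNIV (s # ss) U \<longleftrightarrow>
    t \<in> triples s U \<and> us \<in> packings UNIV ss (U \<union> entries t)"
  by auto

lemma length_packings: "ts \<in> packings V ss U \<Longrightarrow> length ts = length ss"
  by (induction ss arbitrary: ts U) auto

lemma distinct_packings:
  "ts \<in> packings V ss U \<Longrightarrow>
    distinct (concat (map entry_list ts)) \<and> set (concat (map entry_list ts)) \<inter> U = {}"
proof (induction ss arbitrary: U ts)
  case Nil
  then show ?case by simp
next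
  case (Cons s ss)
  then obtain t us where t: "t \<in> triples s U" and us: "us \<in> packings V ss (U \<union> entries t)"
    and ts: "ts = t # us"
    by auto
  have "distinct (entry_list t)" "entries t \<inter> U = {}"
    using t by (auto simp: triples_def)
  then show ?case
    using Cons.IH[OF us] unfolding ts list.map concat.simps set_append distinct_append set_entry_list
    by blast
qed

lemma admissible_iff_packing:
  "([a1, a2, a3, a4, a5], [b1, b2, b3, b4, b5], [c1, c2, c3, c4]) \<in> admissible \<and>
     c5' = 43 - a5 - b5 \<longleftrightarrow>
   [(a1, b1, c1), (a2, b2, c2), (a3, b3, c3), (a4, b4, c4), (a5, b5, c5')]
     \<in> packings UNIV target_sums {}"
proof (cases "a5 + b5 + c5' = 43")
  case True
  then have c5': "c5 ([a1, a2, a3, a4, a5], [b1, b2, b3, b4, b5], [c1, c2, c3, c4]) = c5'"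
    "43 - a5 - b5 = c5'"
    by simp_all
  \<comment> \<open>Both sides unfold to the same conditions up to the orientation of some
    disequalities, which \<open>not_sym\<close> adjusts.\<close>
  show ?thesis
    unfolding Cons_in_packings_UNIV
    by (simp add: admissible_def all_less_4 triples_def c5' True del: c5.simps)
      (rule iffI; elim conjE; intro conjI; (assumption | (rule not_sym, assumption)))
next
  case False
  then show ?thesis
    unfolding Cons_in_packings_UNIV by (auto simp: triples_def)
qed

text \<open>The inverse transposes the columns back into rows; \<open>take 4\<close> drops
  \<open>c5\<close>, which the fifth sum 43 restores.\<close>

lemma bij_betw_initial_columns:
  "bij_betw initial_columns admissible (packings UNIV target_sums {})"
proof (rule bij_betw_byWitness[where f' = "\<lambda>ts. (map fst ts, map (fst \<circ> snd) ts, map (snd \<circ> snd) (take 4 ts))"])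
  show "\<forall>s\<in>admissible. (map fst (initial_columns s), map (fst \<circ> snd) (initial_columns s),
      map (snd \<circ> snd) (take 4 (initial_columns s))) = s"
    by (auto elim!: admissibleE simp: upt_1_6)
  have *: "ts \<in> packings UNIV target_sums {} \<Longrightarrow> \<exists>a1 a2 a3 a4 a5 b1 b2 b3 b4 b5 c1 c2 c3 c4 c5'.
      ts = [(a1, b1, c1), (a2, b2, c2), (a3, b3, c3), (a4, b4, c4), (a5, b5, c5')] \<and>
      c5' = 43 - a5 - b5 \<and>
      ([a1, a2, a3, a4, a5], [b1, b2, b3, b4, b5], [c1, c2, c3, c4]) \<in> admissible" for ts
  proof -
    assume ts: "ts \<in> packings UNIV target_sums {}"
    then have "length ts = 5"
      using length_packings by fastforce
    with ts show ?thesis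
      unfolding length_eq_5 split_paired_Ex by (metis admissible_iff_packing)
  qed
  show "\<forall>ts\<in>packings UNIV target_sums {}.
      initial_columns (map fst ts, map (fst \<circ> snd) ts, map (snd \<circ> snd) (take 4 ts)) = ts"
    by (auto dest!: * simp: upt_1_6 simp del: packings.simps)
  show "(\<lambda>ts. (map fst ts, map (fst \<circ> snd) ts, map (snd \<circ> snd) (take 4 ts))) `
      packings UNIV target_sums {} \<subseteq> admissible"
    by (auto dest!: * simp del: packings.simps)
  show "initial_columns ` admissible \<subseteq> packings UNIV target_sums {}"
  proof (intro image_subsetI)
    fix s
    assume s: "s \<in> admissible"
    then obtain a1 a2 a3 a4 a5 b1 b2 b3 b4 b5 c1 c2 c3 c4 where
      s_eq: "s = ([a1, a2, a3, a4, a5], [b1, b2, b3, b4, b5], [c1, c2, c3, c4])"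
      by (elim admissibleE)
    show "initial_columns s \<in> packings UNIV target_sums {}"
      using s unfolding s_eq
      by (simp add: upt_1_6 del: packings.simps) (rule iffD1[OF admissible_iff_packing], simp)
  qed
qed

lemma card_admissible: "card admissible = 36 * 6 ^ 5"
proof -
  have "card admissible = card (packings UNIV target_sums {})"
    using bij_betw_initial_columns by (rule bij_betw_same_card)
  also have "\<dots> = 6 ^ 5 * card (packings increasing target_sums (set []))"
    using card_packings_increasing[of target_sums "{}"] by simp
  finally show ?thesis
    unfolding set_increasing_packings[symmetric] card_increasing_packings by simp
qed

section \<open>The algorithm after the initial columns\<close>

definition used :: "stmt \<Rightarrow> nat \<Rightarrow> int set" where
  "used s n = (\<Union>k\<in>{1..<n}. entries (algorithm s k))"

lemma algorithm_initial: "n \<le> 5 \<Longrightarrow> algorithm s n = initial_column s n"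
  by (subst algorithm.simps) simp

lemma used_6: "used s 6 = first_five (initial_column s)"
proof -
  have "{1..<6} = {1..5::nat}"
    by auto
  then show ?thesis
    by (simp add: used_def first_five_def algorithm_initial)
qed

lemma used_Suc: "1 \<le> n \<Longrightarrow> used s (Suc n) = used s n \<union> entries (algorithm s n)"
  by (auto simp: used_def atLeastLessThanSuc)

lemma entries_subset_used: "1 \<le> j \<Longrightarrow> j < k \<Longrightarrow> entries (algorithm s j) \<subseteq> used s k"
  by (auto simp: used_def)

lemma algorithm_eqI:
  assumes "6 \<le> n" "0 \<le> a" "a < b" "a \<notin> used s n" "b \<notin> used s n"
    "\<And>x. 0 \<le> x \<Longrightarrow> x < b \<Longrightarrow> x \<noteq> a \<Longrightarrow> x \<in> used s n"
  shows "algorithm s n = (a, b, S n - a - b)"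
proof -
  have a: "(LEAST x. 0 \<le> x \<and> x \<notin> used s n) = a"
    by (rule Least_equality) (use assms in \<open>force+\<close>)
  have b: "(LEAST x. a < x \<and> x \<notin> used s n) = b"
  proof (rule Least_equality)
    fix y
    assume "a < y \<and> y \<notin> used s n"
    with assms(2) assms(6)[of y] show "b \<le> y"
      by force
  qed (use assms in blast)
  from \<open>6 \<le> n\<close> show ?thesis
    by (subst algorithm.simps) (simp only: used_def[symmetric] Let_def a b, simp)
qed

fun greedy_columns :: "int list \<Rightarrow> int list \<Rightarrow> column list" where
  "greedy_columns (s # ss) (a # b # F) =
     (a, b, s - a - b) # greedy_columns ss (remove1 (s - a - b) F)"
| "greedy_columns _ _ = []"

text \<open>\<open>F\<close> lists the unused numbers up to some bound \<open>N\<close>; numbers beyond \<open>N\<close> need not be tracked,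
  since \<open>greedy_columns\<close> would stop early if \<open>F\<close> were exhausted.\<close>

lemma map_algorithm_greedy:
  assumes "sorted F" "distinct F" "set F = {0..N} - used s n" "6 \<le> n"
    "length (greedy_columns (map S [n..<n + k]) F) = k"
  shows "map (algorithm s) [n..<n + k] = greedy_columns (map S [n..<n + k]) F"
  using assms
proof (induction k arbitrary: n F)
  case 0
  then show ?case by simp
next
  case (Suc k)
  have upt: "[n..<n + Suc k] = n # [Suc n..<Suc n + k]"
    by (simp add: upt_rec)
  \<comment> \<open>With fewer than two free numbers left, \<open>greedy_columns\<close> would
    return no column here, against the length assumption.\<close>
  obtain a b G where F: "F = a # b # G"
    using Suc.prems(5) unfolding upt
    by (cases F rule: list.exhaust[case_product list.exhaust[of "tl F"]]) auto
  have ab: "a \<in> {0..N} - used s n" "b \<in> {0..N} - used s n" "a < b"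
    using Suc.prems(1,2) unfolding Suc.prems(3)[symmetric] F by auto
  have col: "algorithm s n = (a, b, S n - a - b)"
  proof (rule algorithm_eqI)
    fix x
    assume x: "0 \<le> x" "x < b" "x \<noteq> a"
    show "x \<in> used s n"
    proof (rule ccontr)
      assume "x \<notin> used s n"
      with x ab have "x \<in> set F"
        by (subst Suc.prems(3)) auto
      with x Suc.prems(1) show False
        by (auto simp: F)
    qed
  qed (use ab Suc.prems(4) in auto)
  let ?F = "remove1 (S n - a - b) G"
  have len: "length (greedy_columns (map S [Suc n..<Suc n + k]) ?F) = k"
    using Suc.prems(5) unfolding F upt by (simp del: upt_Suc)
  have "map (algorithm s) [Suc n..<Suc n + k] = greedy_columns (map S [Suc n..<Suc n + k]) ?F"
  proof (rule Suc.IH)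
    show "set ?F = {0..N} - used s (Suc n)"
      using Suc.prems(2-4) col by (auto simp: used_Suc F)
  qed (use Suc.prems(1,2,4) len in \<open>auto simp: F sorted_remove1\<close>)
  then show ?case
    unfolding upt by (simp add: col F del: upt_Suc)
qed

section \<open>The regime after column 13 and the propagation of deviations\<close>

text \<open>The finite data sufficient for the whole future of the run: 0 to 32 are filled, and the
  only further used numbers are the third entries of columns 8 to 13, each within 2 of its standard
  value 35, 40, ..., 60. \<open>used_14\<close> and \<open>near_13\<close> are the block invariant
  for \<open>m = 7\<close>.\<close>

locale settled =
  fixes s :: stmt
  assumes distinct_13: "distinct (concat (map (entry_list \<circ> algorithm s) [1..<14]))"
    and used_14: "used s 14 = {0..32} \<union> (\<lambda>n. third (algorithm s n)) ` {8..13}"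
    and near_13: "\<And>n. 8 \<le> n \<Longrightarrow> n \<le> 13 \<Longrightarrow> \<bar>third (algorithm s n) - (5 * int n - 5)\<bar> \<le> 2"
begin

definition dev :: "nat \<Rightarrow> int" where
  "dev n = third (algorithm s n) - (5 * int n - 5)"

text \<open>From index 14 on the columns \<open>2 * m\<close> and \<open>2 * m + 1\<close> have their first two entries in the block
  \<open>{5 * m - 2..5 * m + 2}\<close>, which contains exactly one earlier third entry, that of column
  \<open>m + 1\<close>.\<close>

definition block_inv :: "nat \<Rightarrow> bool" where
  "block_inv m \<longleftrightarrow> used s (2 * m) = {0..5 * int m - 3} \<union> (\<lambda>n. 5 * int n - 5 + dev n) ` {m + 1..2 * m - 1} \<and>
     (\<forall>n\<in>{m + 1..2 * m - 1}. \<bar>dev n\<bar> \<le> 2)"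

lemma block_inv_7: "block_inv 7"
  using used_14 near_13 by (simp add: block_inv_def dev_def)

text \<open>Third entries of columns from \<open>m + 2\<close> on are at least
  \<open>5 * (m + 1) - 2 = 5 * m + 3\<close>, beyond the block; only column \<open>m + 1\<close> can
  reach into it.\<close>

lemma block_used:
  assumes m: "7 \<le> m" and inv: "block_inv m" and x: "0 \<le> x" "x \<le> 5 * int m + 2"
  shows "x \<in> used s (2 * m) \<longleftrightarrow> x \<le> 5 * int m - 3 \<or> x = 5 * int m + dev (m + 1)"
proof -
  have "n = m + 1" if "n \<in> {m + 1..2 * m - 1}" "x = 5 * int n - 5 + dev n" for n
  proof -
    have "\<bar>dev n\<bar> \<le> 2"
      using inv that(1) unfolding block_inv_def by blast
    with that x have "int n < int m + 2"
      by linarith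
    with that(1) show ?thesis
      by simp
  qed
  moreover have "5 * int (m + 1) - 5 + dev (m + 1) = 5 * int m + dev (m + 1)"
    "m + 1 \<in> {m + 1..2 * m - 1}"
    using m by auto
  ultimately have "x \<in> (\<lambda>n. 5 * int n - 5 + dev n) ` {m + 1..2 * m - 1} \<longleftrightarrow>
      x = 5 * int m + dev (m + 1)"
    unfolding image_iff by metis
  then show ?thesis
    using inv x unfolding block_inv_def by auto
qed

text \<open>The extreme case is column \<open>2 * m - 1\<close>:
  \<open>5 * (2 * m - 1) - 5 + 2 = 10 * m - 8\<close>. The next third entries are at least
  \<open>10 * m - 7\<close>, hence new.\<close>

lemma used_bound:
  assumes "7 \<le> m" "block_inv m" "x \<in> used s (2 * m)"
  shows "x \<le> 10 * int m - 8"
proof -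
  have "5 * int n - 5 + dev n \<le> 10 * int m - 8" if "n \<in> {m + 1..2 * m - 1}" for n
  proof -
    have "\<bar>dev n\<bar> \<le> 2"
      using assms(2) that unfolding block_inv_def by blast
    moreover have "int n \<le> 2 * int m - 1"
      using that assms(1) by auto
    ultimately show ?thesis
      by linarith
  qed
  with assms show ?thesis
    by (auto simp: block_inv_def)
qed

text \<open>The block lacks only \<open>5 * m + e\<close>; its other four elements split into a
  lower and an upper pair. If \<open>e < 0\<close>, the lower pair's sum exceeds the standard one by
  \<open>-e\<close>; if \<open>e > 0\<close>, the upper pair's sum falls short by \<open>e\<close>.
  The third entry compensates this because the column sum is fixed.\<close>

lemma block_columns:
  assumes m: "7 \<le> m" and inv: "block_inv m"
  defines "e \<equiv> dev (m + 1)"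
  shows "algorithm s (2 * m) =
      (5 * int m - 2 + (if e = -2 then 1 else 0), 5 * int m - 1 + (if e < 0 then 1 else 0),
       10 * int m - 5 + min e 0)" (is ?even)
    and "algorithm s (2 * m + 1) =
      (5 * int m + 1 - (if 0 < e then 1 else 0), 5 * int m + 2 - (if e = 2 then 1 else 0),
       10 * int m + max e 0)" (is ?odd)
    and "used s (2 * m + 2) = used s (2 * m) \<union> entries (algorithm s (2 * m)) \<union>
      entries (algorithm s (2 * m + 1))"
proof -
  have e: "\<bar>e\<bar> \<le> 2"
    using m inv by (simp add: block_inv_def e_def)
  note used = block_used[OF assms(1,2), folded e_def]
  have S_even: "S (2 * m) = 20 * int m - 8" and S_odd: "S (Suc (2 * m)) = 20 * int m + 3"
    by (simp_all add: S_def)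
  from e have cases: "e = -2 \<or> e = -1 \<or> e = 0 \<or> e = 1 \<or> e = 2"
    by linarith
  have even: "algorithm s (2 * m) =
      (5 * int m - 2 + (if e = -2 then 1 else 0), 5 * int m - 1 + (if e < 0 then 1 else 0),
       S (2 * m) - (5 * int m - 2 + (if e = -2 then 1 else 0)) -
         (5 * int m - 1 + (if e < 0 then 1 else 0)))"
    by (rule algorithm_eqI) (use m cases in \<open>auto simp: used\<close>)
  then show ?even
    using cases by (auto simp: S_even)
  have used': "used s (2 * m + 1) = used s (2 * m) \<union> entries (algorithm s (2 * m))"
    using used_Suc[of "2 * m"] m by simp
  \<comment> \<open>The third entry of column \<open>2 * m\<close> is at least
    \<open>10 * m - 7 > 5 * m + 2\<close>, so it does not affect the block.\<close>
  have used_odd: "x \<in> used s (Suc (2 * m)) \<longleftrightarrow> x \<in> used s (2 * m) \<or> x = fst (algorithm s (2 * m)) \<or>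
      x = fst (snd (algorithm s (2 * m)))" if "x \<le> 5 * int m + 2" for x
    unfolding Suc_eq_plus1 used' \<open>?even\<close> using that m cases by auto
  have odd: "algorithm s (2 * m + 1) =
      (5 * int m + 1 - (if 0 < e then 1 else 0), 5 * int m + 2 - (if e = 2 then 1 else 0),
       S (2 * m + 1) - (5 * int m + 1 - (if 0 < e then 1 else 0)) -
         (5 * int m + 2 - (if e = 2 then 1 else 0)))"
    by (rule algorithm_eqI) (use m cases in \<open>auto simp: used_odd used \<open>?even\<close>\<close>)
  then show ?odd
    using cases by (auto simp: S_odd)
  show "used s (2 * m + 2) = used s (2 * m) \<union> entries (algorithm s (2 * m)) \<union>
      entries (algorithm s (2 * m + 1))"
    using used_Suc[of "2 * m + 1"] used' by simp
qed

lemma dev_block: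
  assumes "7 \<le> m" "block_inv m"
  shows "dev (2 * m) = min (dev (m + 1)) 0" "dev (2 * m + 1) = max (dev (m + 1)) 0"
  using block_columns[OF assms] by (simp_all add: dev_def[of "2 * m"] dev_def[of "2 * m + 1"] dev_def[of "Suc (2 * m)"])

text \<open>Columns \<open>2 * m\<close> and \<open>2 * m + 1\<close> complete the block, so the
  interval grows by five. The third entry of column \<open>m + 1\<close> is absorbed into it, and
  two new third entries join the list of those ahead.\<close>

lemma block_inv_Suc:
  assumes m: "7 \<le> m" and inv: "block_inv m"
  shows "block_inv (Suc m)"
proof -
  let ?e = "dev (m + 1)" and ?g = "\<lambda>n. 5 * int n - 5 + dev n"
  have e: "\<bar>?e\<bar> \<le> 2"
    using m inv by (simp add: block_inv_def)
  have cases: "?e = -2 \<or> ?e = -1 \<or> ?e = 0 \<or> ?e = 1 \<or> ?e = 2"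
    using e by linarith
  have low: "{m + 1..2 * m - 1} = insert (m + 1) {m + 2..2 * m - 1}"
    using m by auto
  have high: "{Suc m + 1..2 * Suc m - 1} = insert (2 * m) (insert (2 * m + 1) {m + 2..2 * m - 1})"
    using m by auto
  have block: "{0..5 * int m - 3} \<union> {5 * int m + ?e} \<union>
      {5 * int m - 2 + (if ?e = -2 then 1 else 0), 5 * int m - 1 + (if ?e < 0 then 1 else 0)} \<union>
      {5 * int m + 1 - (if 0 < ?e then 1 else 0), 5 * int m + 2 - (if ?e = 2 then 1 else 0)} =
      {0..5 * int (Suc m) - 3}"
    using cases m by (elim disjE) auto
  have "used s (2 * Suc m) = used s (2 * m) \<union> entries (algorithm s (2 * m)) \<union>
      entries (algorithm s (2 * m + 1))"
    using block_columns(3)[OF m inv] by simp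
  also have "used s (2 * m) = {0..5 * int m - 3} \<union> {5 * int m + ?e} \<union> ?g ` {m + 2..2 * m - 1}"
    using inv unfolding block_inv_def low by auto
  also have "entries (algorithm s (2 * m)) =
      {5 * int m - 2 + (if ?e = -2 then 1 else 0), 5 * int m - 1 + (if ?e < 0 then 1 else 0)} \<union>
      {?g (2 * m)}"
    unfolding block_columns(1)[OF m inv] using dev_block(1)[OF m inv] by auto
  also have "entries (algorithm s (2 * m + 1)) =
      {5 * int m + 1 - (if 0 < ?e then 1 else 0), 5 * int m + 2 - (if ?e = 2 then 1 else 0)} \<union>
      {?g (2 * m + 1)}"
    unfolding block_columns(2)[OF m inv] using dev_block(2)[OF m inv] by auto
  finally have "used s (2 * Suc m) = {0..5 * int (Suc m) - 3} \<union> ?g ` {Suc m + 1..2 * Suc m - 1}"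
    unfolding high block[symmetric] by (simp add: Un_ac insert_commute)
  moreover have "\<bar>dev n\<bar> \<le> 2" if "n \<in> {Suc m + 1..2 * Suc m - 1}" for n
  proof (cases "n \<in> {m + 1..2 * m - 1}")
    case True
    then show ?thesis
      using inv by (simp add: block_inv_def)
  next
    case False
    with that m have "n = 2 * m \<or> n = 2 * m + 1"
      by auto
    then show ?thesis
      using dev_block[OF m inv] e by (auto simp: min_def max_def)
  qed
  ultimately show ?thesis
    by (simp add: block_inv_def)
qed

lemma block_inv: "7 \<le> m \<Longrightarrow> block_inv m"
  by (induction m rule: dec_induct) (simp_all add: block_inv_7 block_inv_Suc)

lemma dev_double:
  assumes "7 \<le> m"
  shows "dev (2 * m) = min (dev (m + 1)) 0" "dev (2 * m + 1) = max (dev (m + 1)) 0"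
  using dev_block block_inv assms by blast+

lemma dev_bound: "8 \<le> n \<Longrightarrow> \<bar>dev n\<bar> \<le> 2"
  using block_inv[of "n - 1"] by (simp add: block_inv_def)

text \<open>Strong induction: for \<open>n > 13\<close> the deviation is inherited from index
  \<open>n div 2 + 1\<close>, which is smaller than \<open>n\<close> and at least 8.\<close>

lemma dev_eq_0:
  assumes "\<And>n. 8 \<le> n \<Longrightarrow> n \<le> 13 \<Longrightarrow> dev n = 0" "8 \<le> n"
  shows "dev n = 0"
  using assms(2)
proof (induction n rule: less_induct)
  case (less n)
  show ?case
  proof (cases "n \<le> 13")
    case True
    with assms(1) less.prems show ?thesis by blast
  next
    case False
    then have "7 \<le> n div 2" "n div 2 + 1 < n"
      by auto
    moreover from this have "dev (n div 2 + 1) = 0"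
      using less.IH[of "n div 2 + 1"] by simp
    ultimately have "dev (2 * (n div 2)) = 0" "dev (2 * (n div 2) + 1) = 0"
      using dev_double[of "n div 2"] by simp_all
    then show ?thesis
      by (metis Suc_eq_plus1 odd_two_times_div_two_succ dvd_mult_div_cancel)
  qed
qed

lemma equivalent_standardI:
  assumes "\<And>n. 8 \<le> n \<Longrightarrow> n \<le> 13 \<Longrightarrow> dev n = 0"
  shows "equivalent (algorithm s) standard"
  unfolding equivalent_def
proof (intro exI allI impI)
  fix n :: nat
  \<comment> \<open>The witness is \<open>N = 13\<close>: with zero deviation,
    \<open>block_columns\<close> yields exactly the standard columns.\<close>
  assume n: "13 < n"
  define m where "m = n div 2"
  have m: "7 \<le> m"
    using n by (auto simp: m_def)
  have "dev (m + 1) = 0"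
    using dev_eq_0[OF assms] m by simp
  moreover have "n = 2 * m \<or> n = 2 * m + 1"
    by (auto simp: m_def)
  ultimately show "algorithm s n = standard n"
    using block_columns(1,2)[OF m block_inv[OF m]] by (auto simp: standard_def)
qed

text \<open>A nonzero deviation at \<open>k\<close> survives at \<open>2 * (k - 1)\<close> if
  negative and at \<open>2 * (k - 1) + 1\<close> if positive. Both indices exceed \<open>k\<close>,
  so nonzero deviations occur arbitrarily far out.\<close>

lemma not_equivalent_standardI:
  assumes "8 \<le> n" "dev n \<noteq> 0"
  shows "\<not> equivalent (algorithm s) standard"
proof
  assume "equivalent (algorithm s) standard"
  then obtain N where N: "\<And>k. N < k \<Longrightarrow> algorithm s k = standard k"
    by (auto simp: equivalent_def)
  have "\<exists>k>M. 8 \<le> k \<and> dev k \<noteq> 0" for M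
  proof (induction M)
    case 0
    show ?case using assms by (intro exI[of _ n]) auto
  next
    case (Suc M)
    then obtain k where k: "M < k" "8 \<le> k" "dev k \<noteq> 0"
      by blast
    then have "dev (2 * (k - 1)) = min (dev k) 0" "dev (2 * (k - 1) + 1) = max (dev k) 0"
      using dev_double[of "k - 1"] by simp_all
    with k have "dev (2 * (k - 1)) \<noteq> 0 \<or> dev (2 * (k - 1) + 1) \<noteq> 0"
      by (auto simp: min_def max_def)
    moreover have "Suc M < 2 * (k - 1)" "8 \<le> 2 * (k - 1)"
      using k by auto
    ultimately show ?case
      by (metis less_SucI trans_le_add1 Suc_eq_plus1)
  qed
  then obtain k where "N < k" "dev k \<noteq> 0"
    by blast
  with N[of k] show False
    by (simp add: dev_def standard_def)
qed

lemma equivalent_standard_iff: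
  "equivalent (algorithm s) standard \<longleftrightarrow> (\<forall>n\<in>{8..13}. dev n = 0)"
  using equivalent_standardI not_equivalent_standardI by fastforce

section \<open>The algorithm yields a partition\<close>

text \<open>The first two entries are free elements of the block. The third is fixed by the sum, so
  its freshness needs an argument: it exceeds the bound of \<open>used_bound\<close>, and in the odd
  column also the third entry of column \<open>2 * m\<close>.\<close>

lemma fresh_block_columns:
  assumes m: "7 \<le> m" and inv: "block_inv m"
  shows "distinct (entry_list (algorithm s (2 * m))) \<and>
      entries (algorithm s (2 * m)) \<inter> used s (2 * m) = {}"
    and "distinct (entry_list (algorithm s (2 * m + 1))) \<and>
      entries (algorithm s (2 * m + 1)) \<inter> used s (2 * m + 1) = {}"
proof -
  have "\<bar>dev (m + 1)\<bar> \<le> 2"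
    using dev_bound m by simp
  then have cases: "dev (m + 1) = -2 \<or> dev (m + 1) = -1 \<or> dev (m + 1) = 0 \<or> dev (m + 1) = 1 \<or>
      dev (m + 1) = 2"
    by linarith
  have above: "x \<notin> used s (2 * m)" if "10 * int m - 8 < x" for x
    using used_bound[OF m inv, of x] that by auto
  note cols = block_columns(1,2)[OF m inv]
  show "distinct (entry_list (algorithm s (2 * m))) \<and>
      entries (algorithm s (2 * m)) \<inter> used s (2 * m) = {}"
    unfolding cols using cases m by (elim disjE) (auto simp: block_used[OF m inv] above)
  have "used s (2 * m + 1) = used s (2 * m) \<union> entries (algorithm s (2 * m))"
    using used_Suc[of "2 * m"] m by simp
  then show "distinct (entry_list (algorithm s (2 * m + 1))) \<and>
      entries (algorithm s (2 * m + 1)) \<inter> used s (2 * m + 1) = {}"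
    unfolding cols using cases m by (elim disjE) (auto simp: block_used[OF m inv] above)
qed

lemma fresh_column:
  assumes "1 \<le> n"
  shows "distinct (entry_list (algorithm s n)) \<and> entries (algorithm s n) \<inter> used s n = {}"
proof (cases "n \<le> 13")
  case True
  have "[1..<14] = [1..<n] @ n # [Suc n..<14]"
    using assms True upt_add_eq_append[of 1 n "14 - n"] by (simp add: upt_conv_Cons)
  with distinct_13 have "distinct (concat (map (entry_list \<circ> algorithm s) [1..<n]) @
      entry_list (algorithm s n))"
    by (simp only: map_append list.map concat_append concat.simps distinct_append o_apply
        set_append) blast
  moreover have "set (concat (map (entry_list \<circ> algorithm s) [1..<n])) = used s n"
    by (simp only: set_concat set_map image_image o_apply set_entry_list set_upt used_def)
  ultimately show ?thesis
    unfolding distinct_append set_entry_list by blast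
next
  case False
  define m where "m = n div 2"
  have m: "7 \<le> m"
    using False by (auto simp: m_def)
  have "n = 2 * m \<or> n = 2 * m + 1"
    by (auto simp: m_def)
  then show ?thesis
    using fresh_block_columns[OF m block_inv[OF m]] by blast
qed

lemma ex_used:
  assumes "0 \<le> x"
  shows "\<exists>n\<ge>1. x \<in> entries (algorithm s n)"
proof -
  \<comment> \<open>Large enough that \<open>x\<close> lies in the filled interval
    \<open>{0..5 * m - 3}\<close>.\<close>
  define m where "m = nat x + 7"
  have "x \<in> used s (2 * m)"
    using block_inv[of m] assms by (simp add: block_inv_def m_def)
  then show ?thesis
    by (auto simp: used_def)
qed

lemma entries_nonneg:
  assumes "1 \<le> n"
  shows "entries (algorithm s n) \<subseteq> {0..}"
proof -
  have inv: "block_inv (n + 7)"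
    by (rule block_inv) simp
  have "entries (algorithm s n) \<subseteq> used s (2 * (n + 7))"
    using assms by (intro entries_subset_used) auto
  also have "\<dots> \<subseteq> {0..}"
  proof -
    have "0 \<le> 5 * int k - 5 + dev k" if "k \<in> {n + 7 + 1..2 * (n + 7) - 1}" for k
      using dev_bound[of k] that by auto
    then show ?thesis
      using inv by (auto simp: block_inv_def)
  qed
  finally show ?thesis .
qed

end

lemma is_partitionI:
  assumes "\<And>n. 1 \<le> n \<Longrightarrow> distinct (entry_list (p n))"
    and "\<And>j k. 1 \<le> j \<Longrightarrow> j < k \<Longrightarrow> entries (p j) \<inter> entries (p k) = {}"
    and "(\<Union>n\<in>{1..}. entries (p n)) = {0..}"
  shows "is_partition p"
proof -
  let ?a = "\<lambda>k. fst (p k)" and ?b = "\<lambda>k. fst (snd (p k))" and ?c = "\<lambda>k. third (p k)"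
  have entries: "entries (p k) = {?a k, ?b k, ?c k}" for k
    by (cases "p k") simp
  have dist: "?a k \<noteq> ?b k \<and> ?a k \<noteq> ?c k \<and> ?b k \<noteq> ?c k" if "1 \<le> k" for k
    using assms(1)[OF that] by (cases "p k") simp
  have eq: "j = k" if "1 \<le> j" "1 \<le> k" "x \<in> entries (p j)" "x \<in> entries (p k)" for j k x
    using that assms(2)[of j k] assms(2)[of k j] by (metis IntI empty_iff nat_neq_iff)
  have "inj_on ?a {1..}" "inj_on ?b {1..}" "inj_on ?c {1..}"
    by (rule inj_onI; rule eq; force simp: entries)+
  moreover have "?a ` {1..} \<inter> ?b ` {1..} = {}" "?a ` {1..} \<inter> ?c ` {1..} = {}"
    "?b ` {1..} \<inter> ?c ` {1..} = {}"
  proof -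
    have "?a j \<noteq> ?b k \<and> ?a j \<noteq> ?c k \<and> ?b j \<noteq> ?c k" if "1 \<le> j" "1 \<le> k" for j k
    proof (cases "j = k")
      case False
      with eq[OF that] show ?thesis
        unfolding entries by blast
    qed (use dist that in blast)
    then show "?a ` {1..} \<inter> ?b ` {1..} = {}" "?a ` {1..} \<inter> ?c ` {1..} = {}"
      "?b ` {1..} \<inter> ?c ` {1..} = {}"
      by (auto simp: disjoint_iff)
  qed
  moreover have "?a ` {1..} \<union> ?b ` {1..} \<union> ?c ` {1..} = {0..}"
    unfolding assms(3)[symmetric] entries by auto
  ultimately show ?thesis
    by (simp add: is_partition_def Let_def)
qed

lemma (in settled) is_partition: "is_partition (algorithm s)"
proof (rule is_partitionI)
  show "(\<Union>n\<in>{1..}. entries (algorithm s n)) = {0..}"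
    using ex_used entries_nonneg by fastforce
  show "entries (algorithm s j) \<inter> entries (algorithm s k) = {}" if "1 \<le> j" "j < k" for j k
    using entries_subset_used[OF that] fresh_column[of k] that by fastforce
qed (use fresh_column in blast)

section \<open>The twenty sets\<close>

abbreviation standard_list :: "int list" where
  "standard_list \<equiv> [0, 1, 2, 3, 4, 5, 6, 7, 8, 9, 10, 11, 12, 15, 20]"

abbreviation exceptional_list :: "int list" where
  "exceptional_list \<equiv> [0, 1, 2, 3, 4, 5, 6, 7, 8, 9, 10, 11, 13, 14, 20]"

definition entries_sorted :: "column list \<Rightarrow> int list" where
  "entries_sorted ts = sort (concat (map entry_list ts))"

definition nonstandard_lists :: "int list list" where
  "nonstandard_lists = filter (\<lambda>L. L \<noteq> standard_list)
     (remdups (map entries_sorted (increasing_packings target_sums [])))"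

definition transient_columns :: "int list \<Rightarrow> column list" where
  "transient_columns L =
     greedy_columns [52, 63, 72, 83, 92, 103, 112, 123] (filter (\<lambda>x. x \<notin> set L) [0..62])"

definition transient_thirds :: "int list \<Rightarrow> int list" where
  "transient_thirds L = map third (drop 2 (transient_columns L))"

definition settles :: "int list \<Rightarrow> bool" where
  "settles L \<longleftrightarrow> length (transient_columns L) = 8 \<and>
     sort (L @ concat (map entry_list (transient_columns L))) = [0..32] @ transient_thirds L \<and>
     distinct (L @ concat (map entry_list (transient_columns L))) \<and>
     list_all2 (\<lambda>x y. \<bar>x - y\<bar> \<le> 2) (transient_thirds L) [35, 40, 45, 50, 55, 60] \<and>
     (transient_thirds L = [35, 40, 45, 50, 55, 60] \<longleftrightarrow> L = exceptional_list)"

lemma nonstandard_lists_settle: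
  "length nonstandard_lists = 20 \<and> exceptional_list \<in> set nonstandard_lists \<and>
   list_all settles nonstandard_lists"
  by code_simp

lemma set_entries_sorted: "set (entries_sorted ts) = \<Union> (entries ` set ts)"
  by (simp only: entries_sorted_def set_sort set_concat set_map image_image set_entry_list)

lemma first_five_initial: "first_five (initial_column s) = set (entries_sorted (initial_columns s))"
proof -
  have "{1..5} = {1..<6::nat}"
    by auto
  then show ?thesis
    by (simp only: first_five_def set_entries_sorted set_map set_upt image_image)
qed

lemma first_five_standard: "first_five standard = set standard_list"
proof -
  have "{1..5} = {1, 2, 3, 4, 5::nat}"
    by auto
  then show ?thesis
    by (simp add: first_five_def standard_def insert_commute)
qed

lemma image_comp_Diff:
  assumes "\<And>x. x \<in> A \<Longrightarrow> f (g x) = f z \<longleftrightarrow> g x = z"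
  shows "(f \<circ> g) ` A - {f z} = f ` (g ` A - {z})"
  using assms by force

lemma nonstandard_sets_eq: "nonstandard_sets = set ` set nonstandard_lists"
proof -
  let ?all = "increasing_packings target_sums []" and ?U = "\<lambda>ts. \<Union> (entries ` set ts)"
  have standard: "set (entries_sorted ts) = set standard_list \<longleftrightarrow> entries_sorted ts = standard_list"
    if "ts \<in> set ?all" for ts
  proof -
    have "distinct (entries_sorted ts)"
      using that distinct_packings unfolding set_increasing_packings entries_sorted_def distinct_sort
      by blast
    moreover have "sorted (entries_sorted ts)" "sorted standard_list" "distinct standard_list"
      by (simp_all add: entries_sorted_def)
    ultimately show ?thesis
      by (intro iffI sorted_distinct_set_unique[of "entries_sorted ts" standard_list]) simp_all
  qed
  have "nonstandard_sets = {X. \<exists>s\<in>admissible. X = first_five (initial_column s)} -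
      {set standard_list}"
    by (simp only: nonstandard_sets_def first_five_standard set_diff_eq singleton_iff mem_Collect_eq)
  also have "{X. \<exists>s\<in>admissible. X = first_five (initial_column s)} =
      ?U ` (initial_columns ` admissible)"
    unfolding first_five_initial set_entries_sorted image_image by (simp only: image_def)
  also have "initial_columns ` admissible = packings UNIV target_sums {}"
    using bij_betw_initial_columns by (simp only: bij_betw_def)
  also have "?U ` packings UNIV target_sums {} = ?U ` set ?all"
    by (simp only: Union_packings_increasing set_increasing_packings list.set)
  also have "\<dots> = (set \<circ> entries_sorted) ` set ?all"
    by (simp only: set_entries_sorted comp_def)
  also have "\<dots> - {set standard_list} = set ` (entries_sorted ` set ?all - {standard_list})"
    using standard by (rule image_comp_Diff)
  also have "entries_sorted ` set ?all - {standard_list} = set nonstandard_lists"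
    by (simp only: nonstandard_lists_def set_filter set_remdups set_map set_diff_eq singleton_iff)
  finally show ?thesis .
qed

lemma card_nonstandard_sets: "card nonstandard_sets = 20"
proof -
  have "inj_on set (set nonstandard_lists)"
  proof (rule inj_onI)
    fix K L
    assume KL: "K \<in> set nonstandard_lists" "L \<in> set nonstandard_lists" "set K = set L"
    then have "distinct K" "distinct L"
      using nonstandard_lists_settle by (auto simp: list_all_iff settles_def)
    moreover have "sorted K" "sorted L"
      using KL by (auto simp: nonstandard_lists_def entries_sorted_def
          simp del: increasing_packings.simps)
    ultimately show "K = L"
      using KL(3) sorted_distinct_set_unique by blast
  qed
  moreover have "card (set nonstandard_lists) = length nonstandard_lists"
    by (rule distinct_card) (simp add: nonstandard_lists_def del: increasing_packings.simps)
  ultimately show ?thesis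
    using nonstandard_lists_settle by (simp add: nonstandard_sets_eq card_image)
qed

lemma map_S_6_13: "map S [6..<6 + 8] = [52, 63, 72, 83, 92, 103, 112, 123]"
  by code_simp

lemma upt_8_14: "[8..<14] = [8, 9, 10, 11, 12, 13::nat]"
  by code_simp

lemma settled_if_settles:
  assumes s: "s \<in> admissible" "first_five (initial_column s) = set L" and L: "settles L"
  shows "settled s" and "equivalent (algorithm s) standard \<longleftrightarrow> L = exceptional_list"
proof -
  let ?T = "transient_columns L"
  have T: "map (algorithm s) [6..<6 + 8] = ?T"
    unfolding transient_columns_def map_S_6_13[symmetric]
  proof (rule map_algorithm_greedy)
    show "set (filter (\<lambda>x. x \<notin> set L) [0..62]) = {0..62} - used s 6"
      using s(2) by (auto simp: used_6)
    show "length (greedy_columns (map S [6..<6 + 8]) (filter (\<lambda>x. x \<notin> set L) [0..62])) = 8"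
      using L unfolding settles_def transient_columns_def map_S_6_13 by blast
  qed (simp_all add: sorted_wrt_filter)
  have upt: "[1..<14] = [1..<6] @ [6..<6 + 8::nat]"
    by code_simp
  have "map (algorithm s) [1..<6] = initial_columns s"
    by (rule map_cong) (simp_all add: algorithm_initial)
  with T have columns: "concat (map (entry_list \<circ> algorithm s) [1..<14]) =
      concat (map entry_list (initial_columns s)) @ concat (map entry_list ?T)"
    unfolding upt by (simp only: map_map[symmetric] map_append concat_append)
  have initial: "set (concat (map entry_list (initial_columns s))) = set L"
    using s(2) by (simp only: first_five_initial entries_sorted_def set_sort)
  have thirds: "transient_thirds L = map (\<lambda>n. third (algorithm s n)) [8..<14]"
    unfolding transient_thirds_def T[symmetric] by (simp add: drop_map comp_def)
  have list_all2: "list_all2 (\<lambda>x y. \<bar>x - y\<bar> \<le> 2) (transient_thirds L) [35, 40, 45, 50, 55, 60]"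
    using L unfolding settles_def by blast
  have range: "n \<in> {8, 9, 10, 11, 12, 13}" if "8 \<le> n" "n \<le> 13" for n :: nat
    using that by auto
  show settled: "settled s"
  proof
    have "distinct (concat (map entry_list (initial_columns s)))"
      using s(1) distinct_packings bij_betwE[OF bij_betw_initial_columns] by blast
    moreover have "distinct (L @ concat (map entry_list ?T))"
      using L unfolding settles_def by blast
    ultimately show "distinct (concat (map (entry_list \<circ> algorithm s) [1..<14]))"
      unfolding columns distinct_append initial by blast
    have "used s 14 = set (concat (map (entry_list \<circ> algorithm s) [1..<14]))"
      by (simp only: set_concat set_map image_image o_apply set_entry_list set_upt used_def)
    also have "\<dots> = set (sort (L @ concat (map entry_list ?T)))"
      by (simp only: columns set_append initial set_sort)
    also have "\<dots> = set ([0..32] @ transient_thirds L)"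
      using L unfolding settles_def by metis
    also have "\<dots> = {0..32} \<union> (\<lambda>n. third (algorithm s n)) ` {8..13}"
    proof -
      have "{8..<14} = {8..13::nat}"
        by auto
      then show ?thesis
        by (simp only: thirds set_append set_map set_upt set_upto)
    qed
    finally show "used s 14 = {0..32} \<union> (\<lambda>n. third (algorithm s n)) ` {8..13}" .
    show "\<bar>third (algorithm s n) - (5 * int n - 5)\<bar> \<le> 2" if "8 \<le> n" "n \<le> 13" for n
      using list_all2 range[OF that] unfolding thirds upt_8_14 by auto
  qed
  have "equivalent (algorithm s) standard \<longleftrightarrow> transient_thirds L = [35, 40, 45, 50, 55, 60]"
  proof -
    have "{8..13} = {8, 9, 10, 11, 12, 13::nat}"
      by auto
    then show ?thesis
      unfolding settled.equivalent_standard_iff[OF settled] thirds upt_8_14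
      by (simp add: settled.dev_def[OF settled])
  qed
  also have "\<dots> \<longleftrightarrow> L = exceptional_list"
    using L unfolding settles_def by blast
  finally show "equivalent (algorithm s) standard \<longleftrightarrow> L = exceptional_list" .
qed

theorem mainTheorem2:
  shows "(card admissible = 36 * fact 3 ^ 5 \<and> card admissible = 279936) \<and>
         card nonstandard_sets = 20 \<and>
         (\<forall>f :: int set \<Rightarrow> stmt.
           (\<forall>X\<in>nonstandard_sets. f X \<in> admissible \<and> first_five (initial_column (f X)) = X) \<longrightarrow>
           (let P = (\<lambda>X. algorithm (f X)) ` nonstandard_sets
            in card P = 20 \<and> (\<forall>p\<in>P. is_partition p) \<and>
               (\<exists>!p. p \<in> P \<and> equivalent p standard)))"
proof (intro conjI allI impI)
  show "card admissible = 36 * fact 3 ^ 5" "card admissible = 279936"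
    by (simp_all add: card_admissible fact_numeral)
  show "card nonstandard_sets = 20"
    by (rule card_nonstandard_sets)
next
  fix f :: "int set \<Rightarrow> stmt"
  assume f: "\<forall>X\<in>nonstandard_sets. f X \<in> admissible \<and> first_five (initial_column (f X)) = X"
  let ?g = "\<lambda>X. algorithm (f X)"
  have "first_five (algorithm s) = first_five (initial_column s)" for s
    by (simp add: first_five_def algorithm_initial)
  with f have inj: "inj_on ?g nonstandard_sets"
    by (intro inj_onI) metis
  have settles: "settled (f X)"
    "equivalent (?g X) standard \<longleftrightarrow> X = set exceptional_list" if "X \<in> nonstandard_sets" for X
  proof -
    have L: "settled (f (set L)) \<and> (equivalent (?g (set L)) standard \<longleftrightarrow> L = exceptional_list)"
      if "L \<in> set nonstandard_lists" for L
    proof -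
      have "settles L" "set L \<in> nonstandard_sets"
        using nonstandard_lists_settle that by (auto simp: list_all_iff nonstandard_sets_eq)
      with f show ?thesis
        using settled_if_settles[of "f (set L)" L] by blast
    qed
    from that obtain K where K: "K \<in> set nonstandard_lists" "X = set K"
      by (auto simp: nonstandard_sets_eq)
    show "settled (f X)"
      using L K by blast
    show "equivalent (?g X) standard \<longleftrightarrow> X = set exceptional_list"
      using L[OF K(1)] L[of exceptional_list] nonstandard_lists_settle K(2) by metis
  qed
  have "set exceptional_list \<in> nonstandard_sets"
    using nonstandard_lists_settle unfolding nonstandard_sets_eq by blast
  then have "\<exists>!p. p \<in> ?g ` nonstandard_sets \<and> equivalent p standard"
    using settles(2) by blast
  moreover have "card (?g ` nonstandard_sets) = 20"
    using inj by (simp add: card_image card_nonstandard_sets)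
  moreover have "\<forall>p\<in>?g ` nonstandard_sets. is_partition p"
    using settles(1) settled.is_partition by blast
  ultimately show "let P = ?g ` nonstandard_sets
      in card P = 20 \<and> (\<forall>p\<in>P. is_partition p) \<and> (\<exists>!p. p \<in> P \<and> equivalent p standard)"
    unfolding Let_def by blast
qed

end
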